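(* Let $F$ be a field of characteristic $p>0$. Let $A_1,\dots,A_n$ be subsets of $F$, none of which is a singleton, each of which is a coset $c+H$ of some finite additive subgroup $H$ of $F$ (the subgroups may differ for different $i$). Assume that a polynomial $f\in F[X_1,\dots,X_n]$ contains a monomial $X_1^{k_1}\cdots X_n^{k_n}$ with non-zero coefficient, such that $k_1<|A_1|,\dots,k_n<|A_n|$ and \[\deg(f)\leq k_1+\dots+k_n+(1-p^{-1})\min\{|A_1|,\dots,|A_n|\}-1.\] Then $f(a)\neq 0$ for some grid point $a\in A_1\times\dots\times A_n$.
   Context: $\deg(f)$ denotes the total degree of $f$. *)

theory Defs
  imports
    Complex_Main
    "HOL-Library.FuncSet"
    "HOL-Library.Poly_Mapping"
    "HOL-Computational_Algebra.Computational_Algebra"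
begin

text \<open>
  Multivariate polynomials are finitely supported maps from exponent vectors to coefficients, so
  that the ring operations of \<^theory>\<open>HOL-Library.Poly_Mapping\<close> are the usual polynomial operations.
  The variables are indexed by all of \<^typ>\<open>nat\<close>; the ring $F[X_1,\dots,X_n]$ is
  \<open>{f. mpoly_vars f \<subseteq> {1..n}}\<close>.
\<close>

type_synonym 'a mpoly = "(nat \<Rightarrow>\<^sub>0 nat) \<Rightarrow>\<^sub>0 'a"

abbreviation mpoly_coeff :: "'a::zero mpoly \<Rightarrow> (nat \<Rightarrow>\<^sub>0 nat) \<Rightarrow> 'a" where
  "mpoly_coeff \<equiv> Poly_Mapping.lookup"

abbreviation exponent :: "(nat \<Rightarrow>\<^sub>0 nat) \<Rightarrow> nat \<Rightarrow> nat" where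
  "exponent \<equiv> Poly_Mapping.lookup"

definition mpoly_vars :: "'a::zero mpoly \<Rightarrow> nat set" where
  "mpoly_vars f = (\<Union>m\<in>Poly_Mapping.keys f. Poly_Mapping.keys m)"

definition monom_degree :: "(nat \<Rightarrow>\<^sub>0 nat) \<Rightarrow> nat" where
  "monom_degree m = (\<Sum>i\<in>Poly_Mapping.keys m. exponent m i)"

text \<open>The zero polynomial gets total degree \<open>0\<close>.\<close>

definition total_degree :: "'a::zero mpoly \<Rightarrow> nat" where
  "total_degree f = Max (insert 0 (monom_degree ` Poly_Mapping.keys f))"

definition mpoly_eval :: "'a::comm_semiring_1 mpoly \<Rightarrow> (nat \<Rightarrow> 'a) \<Rightarrow> 'a" where
  "mpoly_eval f a =
     (\<Sum>m\<in>Poly_Mapping.keys f. mpoly_coeff f m * (\<Prod>i\<in>Poly_Mapping.keys m. a i ^ exponent m i))"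

definition add_subgroup :: "'a::ab_group_add set \<Rightarrow> bool" where
  "add_subgroup H \<longleftrightarrow> 0 \<in> H \<and> (\<forall>x\<in>H. \<forall>y\<in>H. x + y \<in> H) \<and> (\<forall>x\<in>H. - x \<in> H)"

definition finite_subgroup_coset :: "'a::ab_group_add set \<Rightarrow> bool" where
  "finite_subgroup_coset A \<longleftrightarrow> (\<exists>c H. add_subgroup H \<and> finite H \<and> A = (+) c ` H)"

end

theory Submission
  imports Defs "HOL-Algebra.Exponent"
begin

text \<open>
  Lagrange interpolation on \<open>A i\<close> gives a weighted sum over \<open>A i\<close> that maps every polynomial to
  the coefficient of \<open>x ^ k\<^sub>i\<close> in its remainder modulo the vanishing polynomial of \<open>A i\<close>. As \<open>A i\<close>
  is invariant under translation by a subgroup of order \<open>q = |A i|\<close>, so is its vanishing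
  polynomial, and comparing Hasse derivatives shows that only \<open>x ^ q\<close>, the constant term and
  monomials \<open>x ^ (p ^ a)\<close> with \<open>p ^ a \<le> q / p\<close> occur in it. Hence each reduction step lowers a degree
  by at least \<open>(1 - 1 / p) q\<close>. Applied to \<open>f\<close>, the product of these weighted sums therefore sees
  only the coefficient at \<open>k\<close>: any other monomial that contributes has too large a degree.
\<close>

section \<open>Hasse derivatives and translation\<close>

text \<open>In characteristic p, iterated derivatives lose information because i! can vanish; the
  binomial form keeps it. For e < i the truncated exponent \<open>e - i\<close> does no harm, since
  the binomial coefficient is 0.\<close>

definition hasse_deriv :: "nat \<Rightarrow> 'a::comm_semiring_1 poly \<Rightarrow> 'a poly" where
  "hasse_deriv i P = (\<Sum>e\<le>degree P. monom (of_nat (e choose i) * coeff P e) (e - i))"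

lemma coeff_hasse_deriv:
  "coeff (hasse_deriv i P) j = of_nat ((j + i) choose i) * coeff P (j + i)"
proof -
  have "coeff (hasse_deriv i P) j =
      (\<Sum>e\<le>degree P. if e = j + i then of_nat (e choose i) * coeff P e else 0)"
    unfolding hasse_deriv_def coeff_sum
  proof (rule sum.cong)
    fix e
    show "coeff (monom (of_nat (e choose i) * coeff P e) (e - i)) j =
        (if e = j + i then of_nat (e choose i) * coeff P e else 0)"
      by (cases "i \<le> e") (auto simp: binomial_eq_0)
  qed simp
  then show ?thesis
    by (auto simp: coeff_eq_0)
qed

lemma degree_hasse_deriv_le: "degree (hasse_deriv i P) \<le> degree P - i"
  by (rule degree_le) (auto simp: coeff_hasse_deriv coeff_eq_0)

text \<open>Taylor expansion valid in every characteristic: expand each (X + h)^e by the binomial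
  theorem.\<close>

lemma coeff_pcompose_translate:
  "coeff (pcompose P [:h, 1:]) i = poly (hasse_deriv i P) h"
proof -
  have "coeff ([:h, 1:] ^ e) i = of_nat (e choose i) * h ^ (e - i)" for e
  proof (cases "i \<le> e")
    case False
    have "degree ([:h, 1:] ^ e) \<le> e"
      using degree_power_le[of "[:h, 1:]" e] by (simp split: if_splits)
    with False show ?thesis
      by (simp add: coeff_eq_0 binomial_eq_0)
  qed (simp add: coeff_linear_poly_power)
  then show ?thesis
    by (simp add: pcompose_altdef poly_altdef[of "map_poly _ _"] degree_map_poly coeff_map_poly
        coeff_sum hasse_deriv_def poly_sum poly_monom mult_ac)
qed

text \<open>By invariance, the i-th Hasse derivative takes the value \<open>coeff P i\<close> at
  every point of \<open>H\<close>. For 0 < i \<le> \<open>degree P\<close> its degree is below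
  \<open>card H\<close>, so it is constant, and its coefficient at the positive index
  \<open>e - i\<close> must vanish.\<close>

lemma translation_invariant_coeff:
  fixes P :: "'a::idom poly"
  assumes inv: "\<And>h. h \<in> H \<Longrightarrow> pcompose P [:h, 1:] = P"
    and card: "card H = degree P" and i: "0 < i" "i < e"
  shows "of_nat (e choose i) * coeff P e = 0"
proof (cases "degree P < i")
  case True
  with i show ?thesis by (simp add: coeff_eq_0)
next
  case False
  have "hasse_deriv i P = [:coeff P i:]"
  proof (rule poly_eqI_degree)
    show "poly (hasse_deriv i P) h = poly [:coeff P i:] h" if "h \<in> H" for h
      using inv[OF that] by (simp flip: coeff_pcompose_translate)
    show "degree (hasse_deriv i P) < card H" "degree [:coeff P i:] < card H"
      using degree_hasse_deriv_le[of i P] False i card by auto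
  qed
  then have "coeff (hasse_deriv i P) (e - i) = 0"
    using i by (simp add: coeff_pCons split: nat.splits)
  with i show ?thesis by (simp add: coeff_hasse_deriv)
qed

section \<open>Vanishing polynomials of cosets\<close>

definition vanishing_poly :: "'a::comm_ring_1 set \<Rightarrow> 'a poly" where
  "vanishing_poly A = (\<Prod>a\<in>A. [:-a, 1:])"

lemma degree_vanishing_poly: "degree (vanishing_poly A) = card A"
  for A :: "'a::idom set"
  by (simp add: vanishing_poly_def degree_prod_eq_sum_degree)

lemma lead_coeff_vanishing_poly: "coeff (vanishing_poly A) (card A) = 1"
  for A :: "'a::idom set"
  using lead_coeff_prod[of "\<lambda>a. [:-a, 1:]" A] degree_vanishing_poly[of A]
  by (simp add: vanishing_poly_def)

lemma poly_vanishing_poly_eq_0: "finite A \<Longrightarrow> a \<in> A \<Longrightarrow> poly (vanishing_poly A) a = 0"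
  by (auto simp: vanishing_poly_def poly_prod intro: prod_zero)

lemma pcompose_vanishing_poly_translate:
  assumes "bij_betw (\<lambda>a. a - h) A A"
  shows "pcompose (vanishing_poly A) [:h, 1:] = vanishing_poly A"
proof -
  have "pcompose (vanishing_poly A) [:h, 1:] = (\<Prod>a\<in>A. [:-(a - h), 1:])"
    by (simp add: vanishing_poly_def pcompose_prod pcompose_pCons)
  also have "\<dots> = vanishing_poly A"
    unfolding vanishing_poly_def using assms by (rule prod.reindex_bij_betw)
  finally show ?thesis .
qed

lemma bij_betw_translate_coset:
  assumes H: "add_subgroup H" and h: "h \<in> H"
  shows "bij_betw (\<lambda>a. a - h) ((+) c ` H) ((+) c ` H)"
proof -
  have *: "x - h \<in> H" "x + h \<in> H" if "x \<in> H" for x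
    using H h that unfolding add_subgroup_def
    by (metis diff_conv_add_uminus, blast)
  show ?thesis
  proof (rule bij_betwI[where g = "\<lambda>a. a + h"])
    show "(\<lambda>a. a - h) \<in> (+) c ` H \<rightarrow> (+) c ` H" "(\<lambda>a. a + h) \<in> (+) c ` H \<rightarrow> (+) c ` H"
      using * by (auto simp: image_iff add_diff_eq[symmetric] add.assoc)
  qed auto
qed

text \<open>Split off the full p-part, e = p^a m. If m > 1, then i = p^a is an admissible index at
  which divisibility fails.\<close>

lemma prime_not_dvd_choose_imp_power:
  fixes e p :: nat
  assumes p: "prime p" and e: "e > 0"
    and dvd: "\<And>i. 0 < i \<Longrightarrow> i < e \<Longrightarrow> p dvd (e choose i)"
  obtains a where "e = p ^ a"
proof -
  have "e \<noteq> 0" "\<not> is_unit p"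
    using e p by auto
  then obtain m where "e = p ^ multiplicity p e * m" "\<not> p dvd m"
    by (rule multiplicity_decompose')
  then obtain a where m: "e = p ^ a * m" "\<not> p dvd m"
    by blast
  from m(2) have "m > 0"
    by (auto intro: Nat.gr0I)
  have "m = 1"
  proof (rule ccontr)
    assume "m \<noteq> 1"
    with \<open>m > 0\<close> have "p ^ a * 1 < p ^ a * m"
      using prime_gt_0_nat[OF p] by (intro mult_strict_left_mono) auto
    then have "p ^ a < e"
      using m(1) by simp
    moreover have "0 < p ^ a"
      using prime_gt_0_nat[OF p] by simp
    ultimately have "p dvd (e choose p ^ a)" "(e choose p ^ a) \<noteq> 0"
      using dvd by (auto simp: binomial_eq_0_iff)
    \<comment> \<open>The count known from Wielandt's proof of Sylow's theorem: the p-adic valuation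
      of (p^a m choose p^a) equals that of m.\<close>
    moreover have "multiplicity p (e choose p ^ a) = 0"
      using const_p_fac[OF \<open>m > 0\<close> p, of a] m by (simp add: not_dvd_imp_multiplicity_0)
    ultimately show False
      using p by (simp add: prime_elem_multiplicity_eq_zero_iff)
  qed
  with m that show thesis by simp
qed

text \<open>Translations by \<open>H\<close> permute the roots, so every positive exponent in the
  support is a power of the characteristic; a smaller power is smaller by at least one factor of
  it.\<close>

lemma coeff_vanishing_poly_coset:
  fixes A :: "'a::idom set"
  assumes char: "CHAR('a) > 0" and A: "finite_subgroup_coset A"
    and e: "coeff (vanishing_poly A) e \<noteq> 0" "e \<noteq> card A"
  shows "e * CHAR('a) \<le> card A"
proof (cases "e = 0")
  case False
  obtain c H where H: "add_subgroup H" "finite H" "A = (+) c ` H"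
    using A by (auto simp: finite_subgroup_coset_def)
  have card: "card H = card A"
    using H by (simp add: card_image)
  have p: "prime CHAR('a)"
    using char by (rule prime_CHAR_semidom)
  have power: "\<exists>a. j = CHAR('a) ^ a" if "coeff (vanishing_poly A) j \<noteq> 0" "j > 0" for j
  proof -
    have "CHAR('a) dvd (j choose i)" if "0 < i" "i < j" for i
    proof -
      have "of_nat (j choose i) * coeff (vanishing_poly A) j = 0"
      proof (rule translation_invariant_coeff[where H = H])
        show "pcompose (vanishing_poly A) [:h, 1:] = vanishing_poly A" if "h \<in> H" for h
          using bij_betw_translate_coset[OF H(1) that] H(3)
          by (intro pcompose_vanishing_poly_translate) simp
      qed (use that card in \<open>simp_all add: degree_vanishing_poly\<close>)
      then show ?thesis
        using \<open>coeff (vanishing_poly A) j \<noteq> 0\<close> by (simp add: of_nat_eq_0_iff_char_dvd)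
    qed
    then show ?thesis
      using prime_not_dvd_choose_imp_power[OF p \<open>j > 0\<close>] by metis
  qed
  have "e < card A"
    using e degree_vanishing_poly[of A] by (metis le_degree le_neq_implies_less)
  \<comment> \<open>The leading exponent is in the support too, so \<open>power\<close> also shows
    that \<open>card A\<close> is a power of the characteristic.\<close>
  then obtain a b where ab: "e = CHAR('a) ^ a" "card A = CHAR('a) ^ b"
    using power[of e] power[of "card A"] e False by (auto simp: lead_coeff_vanishing_poly)
  then have "a < b"
    using \<open>e < card A\<close> prime_gt_1_nat[OF p] by simp
  then have "CHAR('a) ^ Suc a \<le> CHAR('a) ^ b"
    using char by (intro power_increasing) auto
  with ab show ?thesis by (simp add: mult.commute)
qed simp

section \<open>Coefficient functionals\<close>

lemma lagrange_coefficient_weights: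
  fixes A :: "'a::field set"
  assumes "finite A"
  obtains w where "\<And>P. degree P < card A \<Longrightarrow> (\<Sum>a\<in>A. w a * poly P a) = coeff P k"
proof -
  \<comment> \<open>The Lagrange basis polynomials; the weight of \<open>a\<close> will be the
    coefficient of \<open>l a\<close> at \<open>k\<close>.\<close>
  define l where "l a = smult (inverse (\<Prod>b\<in>A - {a}. a - b)) (vanishing_poly (A - {a}))" for a
  have poly_l: "poly (l a) x = (if x = a then 1 else 0)" if "a \<in> A" "x \<in> A" for a x
    using that assms by (auto simp: l_def poly_vanishing_poly_eq_0)
      (auto simp: vanishing_poly_def poly_prod)
  have "(\<Sum>a\<in>A. coeff (l a) k * poly P a) = coeff P k" if "degree P < card A" for P
  proof -
    have "(\<Sum>a\<in>A. smult (poly P a) (l a)) = P"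
    proof (rule poly_eqI_degree)
      show "poly (\<Sum>a\<in>A. smult (poly P a) (l a)) x = poly P x" if "x \<in> A" for x
        using that assms by (simp add: poly_sum poly_l if_distrib sum.delta cong: if_cong)
      have "degree (smult (poly P a) (l a)) \<le> card A - 1" if "a \<in> A" for a
        using that assms by (simp add: l_def degree_vanishing_poly)
      then have "degree (\<Sum>a\<in>A. smult (poly P a) (l a)) \<le> card A - 1"
        using assms by (intro degree_sum_le) auto
      then show "degree (\<Sum>a\<in>A. smult (poly P a) (l a)) < card A"
        using that by linarith
    qed (fact that)
    from arg_cong[OF this, of "\<lambda>P. coeff P k"] show ?thesis
      by (simp add: coeff_sum mult.commute)
  qed
  then show thesis by (rule that)
qed

text \<open>The relation given by the vanishing polynomial replaces a^j, for j \<ge>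
  \<open>card A\<close>, by powers whose exponents are lower by at least \<open>d\<close>. A nonzero
  moment must lead down to the exponent \<open>k\<close>, so unless j = k at least one such drop has
  occurred.\<close>

lemma gapped_coefficient_weights:
  fixes A :: "'a::field set" and d :: real
  assumes fin: "finite A" and k: "k < card A"
    and gap: "\<And>e. coeff (vanishing_poly A) e \<noteq> 0 \<Longrightarrow> e \<noteq> card A \<Longrightarrow> e + d \<le> card A"
  obtains w where "(\<Sum>a\<in>A. w a * a ^ k) = 1"
    and "\<And>j. (\<Sum>a\<in>A. w a * a ^ j) \<noteq> 0 \<Longrightarrow> j = k \<or> k + d \<le> j"
proof -
  obtain w where w: "\<And>P. degree P < card A \<Longrightarrow> (\<Sum>a\<in>A. w a * poly P a) = coeff P k"
    using lagrange_coefficient_weights[OF fin, of k] by blast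
  have w_low: "(\<Sum>a\<in>A. w a * a ^ j) = (if j = k then 1 else 0)" if "j < card A" for j
    using w[of "monom 1 j"] that by (simp add: degree_monom_eq poly_monom)
  have "k + d \<le> j \<or> j = k" if "(\<Sum>a\<in>A. w a * a ^ j) \<noteq> 0" for j
    using that
  proof (induction j rule: less_induct)
    case (less j)
    show ?case
    proof (cases "j < card A")
      case True
      with less.prems show ?thesis by (auto simp: w_low split: if_splits)
    next
      case False
      define q where "q = card A"
      define c where "c = coeff (vanishing_poly A)"
      have reduce: "a ^ j = - (\<Sum>e<q. c e * a ^ (j - q + e))" if "a \<in> A" for a
      proof -
        have "0 = (\<Sum>e\<le>q. c e * a ^ e)"
          using poly_vanishing_poly_eq_0[OF fin that]
          by (simp add: poly_altdef degree_vanishing_poly c_def q_def)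
        also have "\<dots> = (\<Sum>e<q. c e * a ^ e) + a ^ q"
          by (simp add: c_def q_def lead_coeff_vanishing_poly flip: lessThan_Suc_atMost)
        finally have "a ^ q = - (\<Sum>e<q. c e * a ^ e)"
          by (simp add: eq_neg_iff_add_eq_0 add.commute)
        then have "a ^ (j - q) * a ^ q = - (\<Sum>e<q. c e * a ^ (j - q + e))"
          by (simp add: sum_distrib_left power_add mult_ac)
        then show ?thesis
          using False by (simp add: q_def flip: power_add)
      qed
      have "(\<Sum>a\<in>A. w a * a ^ j) = (\<Sum>a\<in>A. - (\<Sum>e<q. c e * (w a * a ^ (j - q + e))))"
        by (intro sum.cong) (simp_all add: reduce sum_distrib_left mult_ac)
      also have "\<dots> = - (\<Sum>e<q. c e * (\<Sum>a\<in>A. w a * a ^ (j - q + e)))"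
        unfolding sum_negf sum_distrib_left by (subst sum.swap) simp
      finally obtain e where e: "e < q" "c e \<noteq> 0" "(\<Sum>a\<in>A. w a * a ^ (j - q + e)) \<noteq> 0"
        using less.prems by (metis (no_types, lifting) lessThan_iff mult_zero_left mult_zero_right
            neg_equal_0_iff_equal sum.neutral)
      have "e + d \<le> q"
        using gap[of e] e by (simp add: c_def q_def)
      moreover have "j - q + e < j"
        using e False by (simp add: q_def)
      note less.IH[OF this e(3)]
      \<comment> \<open>If the reduced exponent is \<open>k\<close>, then j = k + (q - e) \<ge> k +
        d; otherwise it is already at least k + d, and j exceeds it.\<close>
      ultimately show ?thesis
        using False \<open>j - q + e < j\<close> \<open>e < q\<close> by (auto simp: q_def)
    qed
  qed
  with that[of w] w_low[OF k] show thesis by auto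
qed

section \<open>Sums over the grid\<close>

lemma monom_degree_le_total_degree:
  "m \<in> Poly_Mapping.keys f \<Longrightarrow> monom_degree m \<le> total_degree f"
  unfolding total_degree_def by (intro Max_ge) auto

lemma monom_degree_eq_sum:
  "finite I \<Longrightarrow> Poly_Mapping.keys m \<subseteq> I \<Longrightarrow> monom_degree m = (\<Sum>i\<in>I. exponent m i)"
  unfolding monom_degree_def by (intro sum.mono_neutral_left) (auto simp: in_keys_iff)

lemma mpoly_eval_eq_sum:
  assumes "finite I" "mpoly_vars f \<subseteq> I"
  shows "mpoly_eval f a =
    (\<Sum>m\<in>Poly_Mapping.keys f. mpoly_coeff f m * (\<Prod>i\<in>I. a i ^ exponent m i))"
  unfolding mpoly_eval_def
proof (intro sum.cong arg_cong2[of _ _ _ _ "(*)"] refl)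
  fix m assume "m \<in> Poly_Mapping.keys f"
  with assms(2) have "Poly_Mapping.keys m \<subseteq> I"
    by (auto simp: mpoly_vars_def)
  then show "(\<Prod>i\<in>Poly_Mapping.keys m. a i ^ exponent m i) = (\<Prod>i\<in>I. a i ^ exponent m i)"
    using assms(1) by (intro prod.mono_neutral_left) (auto simp: in_keys_iff)
qed

text \<open>Distributivity: on a monomial, the weighted sum over the grid factors into one-variable
  moments, so each variable can be treated separately.\<close>

lemma weighted_grid_sum:
  fixes w :: "nat \<Rightarrow> 'a::comm_ring_1 \<Rightarrow> 'a"
  assumes I: "finite I" "mpoly_vars f \<subseteq> I" and A: "\<And>i. i \<in> I \<Longrightarrow> finite (A i)"
  shows "(\<Sum>a\<in>PiE I A. (\<Prod>i\<in>I. w i (a i)) * mpoly_eval f a) =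
    (\<Sum>m\<in>Poly_Mapping.keys f. mpoly_coeff f m * (\<Prod>i\<in>I. \<Sum>x\<in>A i. w i x * x ^ exponent m i))"
proof -
  have "(\<Sum>a\<in>PiE I A. (\<Prod>i\<in>I. w i (a i)) * mpoly_eval f a) =
      (\<Sum>a\<in>PiE I A. \<Sum>m\<in>Poly_Mapping.keys f.
        mpoly_coeff f m * (\<Prod>i\<in>I. w i (a i) * a i ^ exponent m i))"
    by (simp add: mpoly_eval_eq_sum[OF I] sum_distrib_left prod.distrib mult_ac)
  also have "\<dots> = (\<Sum>m\<in>Poly_Mapping.keys f.
      mpoly_coeff f m * (\<Sum>a\<in>PiE I A. \<Prod>i\<in>I. w i (a i) * a i ^ exponent m i))"
    unfolding sum_distrib_left by (rule sum.swap)
  finally show ?thesis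
    using I A by (simp add: prod_sum_PiE)
qed

text \<open>The only trace of the coset structure is the gap \<open>d\<close> below the leading term
  of each vanishing polynomial. For d = 1 the gap condition holds for all finite sets, and this is
  the Combinatorial Nullstellensatz.\<close>

lemma nonvanishing_on_gapped_grid:
  fixes A :: "nat \<Rightarrow> 'a::field set" and d :: real
  assumes I: "finite I" "mpoly_vars f \<subseteq> I" and A: "\<And>i. i \<in> I \<Longrightarrow> finite (A i)"
    and d: "d \<ge> 0"
    and gap: "\<And>i e. i \<in> I \<Longrightarrow> coeff (vanishing_poly (A i)) e \<noteq> 0 \<Longrightarrow> e \<noteq> card (A i) \<Longrightarrow>
      e + d \<le> card (A i)"
    and k: "mpoly_coeff f k \<noteq> 0" "\<And>i. i \<in> I \<Longrightarrow> exponent k i < card (A i)"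
    and deg: "real (total_degree f) < real (\<Sum>i\<in>I. exponent k i) + d"
  shows "\<exists>a\<in>PiE I A. mpoly_eval f a \<noteq> 0"
proof (rule ccontr)
  assume vanish: "\<not> ?thesis"
  have "\<exists>w. (\<Sum>x\<in>A i. w x * x ^ exponent k i) = 1 \<and>
      (\<forall>j. (\<Sum>x\<in>A i. w x * x ^ j) \<noteq> 0 \<longrightarrow> j = exponent k i \<or> exponent k i + d \<le> j)"
    if "i \<in> I" for i
    using gapped_coefficient_weights[OF A[OF that] k(2)[OF that] gap[OF that]] by metis
  then obtain w where w1: "\<And>i. i \<in> I \<Longrightarrow> (\<Sum>x\<in>A i. w i x * x ^ exponent k i) = 1"
    and w0: "\<And>i j. i \<in> I \<Longrightarrow> (\<Sum>x\<in>A i. w i x * x ^ j) \<noteq> 0 \<Longrightarrow>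
      j = exponent k i \<or> exponent k i + d \<le> j"
    by metis
  \<comment> \<open>\<open>L m\<close> is what the product functional gives on the monomial
    \<open>m\<close>; the aim is that on the support of \<open>f\<close> it singles out
    \<open>k\<close>.\<close>
  define L where "L m = (\<Prod>i\<in>I. \<Sum>x\<in>A i. w i x * x ^ exponent m i)" for m
  have keys: "Poly_Mapping.keys m \<subseteq> I" if "m \<in> Poly_Mapping.keys f" for m
    using I that by (auto simp: mpoly_vars_def)
  have k_key: "k \<in> Poly_Mapping.keys f"
    using k by (simp add: in_keys_iff)
  have L0: "L m = 0" if m: "m \<in> Poly_Mapping.keys f" "m \<noteq> k" for m
  proof (rule ccontr)
    assume "L m \<noteq> 0"
    then have alt: "exponent m i = exponent k i \<or> exponent k i + d \<le> exponent m i"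
      if "i \<in> I" for i
      using w0[OF that] that I by (auto simp: L_def)
    obtain i0 where i0: "exponent m i0 \<noteq> exponent k i0"
      using \<open>m \<noteq> k\<close> by (metis poly_mapping_eqI)
    then have "i0 \<in> I"
      using keys[OF m(1)] keys[OF k_key] by (metis in_keys_iff subsetD)
    \<comment> \<open>The whole excess \<open>d\<close> is charged to the coordinate
      \<open>i0\<close>, where \<open>m\<close> must jump by \<open>d\<close>; as d \<ge> 0, no
      other exponent of \<open>m\<close> is below that of \<open>k\<close>.\<close>
    have "real (\<Sum>i\<in>I. exponent k i) + d = (\<Sum>i\<in>I. exponent k i + (if i = i0 then d else 0))"
      using \<open>i0 \<in> I\<close> I by (simp add: sum.distrib)
    also have "\<dots> \<le> (\<Sum>i\<in>I. real (exponent m i))"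
      using alt i0 d by (intro sum_mono) fastforce
    also have "\<dots> \<le> total_degree f"
      using monom_degree_le_total_degree[OF m(1)] monom_degree_eq_sum[OF I(1) keys[OF m(1)]]
      by (simp flip: of_nat_sum)
    finally show False using deg by simp
  qed
  have "(\<Sum>m\<in>Poly_Mapping.keys f. mpoly_coeff f m * L m) = mpoly_coeff f k * L k"
    using k_key L0 by (subst sum.remove[of _ k]) auto
  moreover have "L k = 1"
    by (simp add: L_def w1)
  moreover have "(\<Sum>m\<in>Poly_Mapping.keys f. mpoly_coeff f m * L m) = 0"
    using weighted_grid_sum[OF I, of A w] A vanish by (simp add: L_def)
  ultimately show False
    using k by simp
qed

theorem theorem1p4:
  fixes p n :: nat
    and A :: "nat \<Rightarrow> 'a::field set"
    and f :: "'a mpoly"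
    and k :: "nat \<Rightarrow>\<^sub>0 nat"
  assumes "CHAR('a) = p" and "p > 0"
    and "n \<ge> 1"
    and "\<And>i. i \<in> {1..n} \<Longrightarrow> \<not> is_singleton (A i)"
    and "\<And>i. i \<in> {1..n} \<Longrightarrow> finite_subgroup_coset (A i)"
    and "mpoly_vars f \<subseteq> {1..n}"
    and "mpoly_coeff f k \<noteq> 0"
    and "\<And>i. i \<in> {1..n} \<Longrightarrow> exponent k i < card (A i)"
    and "real (total_degree f) \<le>
           real (\<Sum>i=1..n. exponent k i)
           + (1 - inverse (real p)) * real (Min ((\<lambda>i. card (A i)) ` {1..n})) - 1"
  shows "\<exists>a \<in> (\<Pi>\<^sub>E i\<in>{1..n}. A i). mpoly_eval f a \<noteq> 0"
proof -
  define M where "M = Min ((\<lambda>i. card (A i)) ` {1..n})"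
  \<comment> \<open>A coset of size q has gap at least q - q/p. Taking the smallest size gives one
    \<open>d\<close> that serves all coordinates.\<close>
  define d where "d = (1 - inverse (real p)) * real M"
  have p1: "inverse (real p) \<le> 1"
    using assms(2) by (simp add: inverse_le_1_iff)
  show ?thesis
  proof (rule nonvanishing_on_gapped_grid[where d = d and k = k])
    show "d \<ge> 0"
      using p1 by (simp add: d_def)
    show "finite (A i)" if "i \<in> {1..n}" for i
      using assms(5)[OF that] by (auto simp: finite_subgroup_coset_def)
    show "e + d \<le> card (A i)"
      if i: "i \<in> {1..n}" and e: "coeff (vanishing_poly (A i)) e \<noteq> 0" "e \<noteq> card (A i)" for i e
    proof -
      have "e * p \<le> card (A i)"
        using coeff_vanishing_poly_coset[OF _ assms(5)[OF i] e] assms(1,2) by simp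
      then have "real e \<le> inverse (real p) * card (A i)"
        using assms(2) by (simp add: field_simps flip: of_nat_mult)
      moreover have "M \<le> card (A i)"
        unfolding M_def using i by (intro Min_le) auto
      then have "d \<le> (1 - inverse (real p)) * card (A i)"
        unfolding d_def using p1 by (intro mult_left_mono) auto
      ultimately show ?thesis by (simp add: algebra_simps)
    qed
    \<comment> \<open>The \<open>- 1\<close> in the assumed degree bound provides the
      strictness.\<close>
    show "real (total_degree f) < real (\<Sum>i\<in>{1..n}. exponent k i) + d"
      using assms(9) by (simp add: d_def M_def)
  qed (use assms(6-8) in auto)
qed

end
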